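(* Let $\mathbb{F}_q$ be a finite field with $q$ elements. For any sequence $\mathcal{S}=(s_i)_{i=0}^\infty$ over $\mathbb{F}_q$ and any positive integer $N$, the $N$th expansion complexity $E_N(\mathcal{S})$ satisfies $$\binom{E_N(\mathcal{S})+1}{2}\leq N.$$
   Context: For a sequence $\mathcal{S}=(s_i)_{i=0}^\infty$ over $\mathbb{F}_q$, its generating function is the formal power series $G(x)=\sum_{i=0}^\infty s_i x^i$ over $\mathbb{F}_q$. For a positive integer $N$, the $N$th expansion complexity $E_N(\mathcal{S})$ is defined to be $0$ if $s_0=\dots=s_{N-1}=0$, and otherwise the least total degree of a nonzero polynomial $h(x,y)\in\mathbb{F}_q[x,y]$ with $h(x,G(x))\equiv 0 \bmod x^N$. *)

theory Defs
  imports "HOL-Computational_Algebra.Computational_Algebra"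
begin

text \<open>
  A bivariate polynomial \<open>h(x,y)\<close> is an element of type \<open>'a poly poly\<close>: a polynomial in \<open>y\<close>
  with coefficients in \<open>F[x]\<close>, so that the coefficient of \<open>x^i y^j\<close> is \<open>coeff (coeff h j) i\<close>.
\<close>

definition total_degree :: "'a::zero poly poly \<Rightarrow> nat" where
  "total_degree h = (if h = 0 then 0 else Max {i + j | i j. coeff (coeff h j) i \<noteq> 0})"

definition subst_fps :: "'a::comm_ring_1 poly poly \<Rightarrow> 'a fps \<Rightarrow> 'a fps" where
  "subst_fps h G = poly (map_poly fps_of_poly h) G"

text \<open>
  The set over which the minimum is taken is never empty, since it contains the degree of \<open>x^N\<close>.
\<close>

definition expansion_complexity :: "(nat \<Rightarrow> 'a::field) \<Rightarrow> nat \<Rightarrow> nat" where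
  "expansion_complexity s N =
     (if \<forall>i<N. s i = 0 then 0
      else (LEAST d. \<exists>h :: 'a poly poly. h \<noteq> 0 \<and> total_degree h = d \<and>
                        fps_X ^ N dvd subst_fps h (Abs_fps s)))"

end

theory Submission imports Defs "HOL-Library.FuncSet" begin

text \<open>
  A count over the finite field: there are \<open>q ^ ((d + 1) choose 2)\<close> polynomials of total degree
  less than \<open>d\<close>, and \<open>q ^ N\<close> possible values of \<open>h(x, G(x))\<close> modulo \<open>x ^ N\<close>.
  If \<open>N < (d + 1) choose 2\<close>, two of the polynomials agree modulo \<open>x ^ N\<close>, and their difference
  witnesses that the expansion complexity is less than \<open>d\<close>.
\<close>

lemma subst_fps_diff: "subst_fps (g - h) G = subst_fps g G - subst_fps h G"
proof -
  have "map_poly fps_of_poly (g - h) = map_poly fps_of_poly g - map_poly fps_of_poly h"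
    by (intro poly_eqI) (simp add: coeff_map_poly fps_of_poly_diff)
  then show ?thesis
    by (simp add: subst_fps_def)
qed

lemma fps_X_power_dvdI:
  fixes f :: "'a::field fps"
  assumes "\<And>n. n < N \<Longrightarrow> fps_nth f n = 0"
  shows "fps_X ^ N dvd f"
proof -
  have "f = fps_X ^ N * fps_shift N f"
    using assms by (intro fps_ext) (simp add: fps_X_power_mult_nth)
  then show ?thesis by (rule dvdI)
qed

text \<open>The bound \<open>d\<close> also makes the set of exponent sums finite, so that
  \<open>Max\<close> is attained and lies below \<open>d\<close>.\<close>

lemma total_degree_less:
  assumes "h \<noteq> 0" and "\<And>i j. coeff (coeff h j) i \<noteq> 0 \<Longrightarrow> i + j < d"
  shows "total_degree h < d"
proof -
  let ?D = "{i + j | i j. coeff (coeff h j) i \<noteq> 0}"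
  have sub: "?D \<subseteq> {..<d}"
    using assms(2) by auto
  then have "finite ?D"
    by (rule finite_subset) simp
  moreover have "?D \<noteq> {}"
    using \<open>h \<noteq> 0\<close> by (auto simp: poly_eq_iff)
  ultimately have "Max ?D \<in> ?D"
    by (rule Max_in)
  with sub show ?thesis
    using \<open>h \<noteq> 0\<close> by (auto simp: total_degree_def)
qed

lemma card_pairs_sum_less: "card {(i, j). i + j < d} = (d + 1) choose 2"
proof -
  have "{(i, j). i + j < d} = (SIGMA i:{..<d}. {..<d - i})"
    by auto
  then have "card {(i, j). i + j < d} = (\<Sum>i<d. d - i)"
    by simp
  \<comment> \<open>Reversing the order of summation, i to d - 1 - i, gives the triangular number in
    a form suited to induction.\<close>
  also have "\<dots> = (\<Sum>i<d. Suc i)"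
    by (subst sum.nat_diff_reindex [symmetric]) (simp add: Suc_diff_Suc)
  also have "\<dots> = (d + 1) choose 2"
    by (induction d) (simp_all add: numeral_2_eq_2)
  finally show ?thesis .
qed

text \<open>Distinct pairs give distinct monomials, so a coefficient family on \<open>I\<close> can
  be read back from its polynomial. The outer exponent is that of y: the pair (k, l) stands for x^k
  y^l.\<close>

lemma coeff_coeff_sum_monom:
  fixes I :: "(nat \<times> nat) set"
  assumes "finite I"
  shows "coeff (coeff (\<Sum>(k, l)\<in>I. monom (monom (c (k, l)) k) l) j) i =
    (if (i, j) \<in> I then c (i, j) else 0)"
proof -
  have "coeff (coeff (\<Sum>(k, l)\<in>I. monom (monom (c (k, l)) k) l) j) i =
      (\<Sum>p\<in>I. if p = (i, j) then c p else 0)"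
    by (auto simp: coeff_sum split_def prod_eq_iff intro!: sum.cong)
  then show ?thesis
    using assms by simp
qed

lemma exists_annihilating_poly:
  fixes G :: "'a::{field, finite} fps"
  assumes "N < (d + 1) choose 2"
  obtains h :: "'a poly poly"
  where "h \<noteq> 0" "total_degree h < d" "fps_X ^ N dvd subst_fps h G"
proof -
  define I where "I = {(i, j). i + j < (d::nat)}"
  \<comment> \<open>Extensional functions are fixed by their values on the index set, so
    \<open>A\<close> and \<open>B\<close> are finite and their cardinalities are powers of
    q.\<close>
  define A where "A = I \<rightarrow>\<^sub>E (UNIV :: 'a set)"
  define B where "B = {..<N} \<rightarrow>\<^sub>E (UNIV :: 'a set)"
  define H where "H c = (\<Sum>(k, l)\<in>I. monom (monom (c (k, l)) k) l)"
    for c :: "nat \<times> nat \<Rightarrow> 'a"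
  define T where "T c = restrict (fps_nth (subst_fps (H c) G)) {..<N}" for c
  have "I \<subseteq> {..<d} \<times> {..<d}"
    by (auto simp: I_def)
  then have fin: "finite I"
    by (rule finite_subset) simp
  have coeff_H: "coeff (coeff (H c) j) i = (if (i, j) \<in> I then c (i, j) else 0)" for c i j
    unfolding H_def by (rule coeff_coeff_sum_monom [OF fin])
  \<comment> \<open>As 0 and 1 differ, q is at least 2, so a larger exponent gives a strictly larger
    power of q.\<close>
  have "card {0, 1 :: 'a} \<le> card (UNIV :: 'a set)"
    by (rule card_mono) auto
  then have "card B < card A"
    using assms fin by (simp add: A_def B_def card_PiE card_pairs_sum_less I_def)
  moreover have "T ` A \<subseteq> B"
    by (auto simp: T_def B_def split: if_splits)
  moreover have "finite B"
    by (simp add: B_def finite_PiE)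
  ultimately have "\<not> inj_on T A"
    by (meson card_inj_on_le leD)
  then obtain c c' where c: "c \<in> A" "c' \<in> A" "T c = T c'" "c \<noteq> c'"
    by (auto simp: inj_on_def)
  \<comment> \<open>Both families are undefined outside \<open>I\<close>, hence they differ at a
    pair inside it.\<close>
  obtain i j where ij: "(i, j) \<in> I" "c (i, j) \<noteq> c' (i, j)"
    using c unfolding A_def by (metis PiE_ext surj_pair)
  define h where "h = H c - H c'"
  have "coeff (coeff h j) i \<noteq> 0"
    using ij by (simp add: h_def coeff_H)
  then have "h \<noteq> 0"
    by auto
  moreover have "total_degree h < d"
    using \<open>h \<noteq> 0\<close> by (rule total_degree_less) (auto simp: h_def coeff_H I_def split: if_splits)
  moreover have "fps_X ^ N dvd subst_fps h G"
  proof (rule fps_X_power_dvdI)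
    fix n assume "n < N"
    then show "fps_nth (subst_fps h G) n = 0"
      using fun_cong [OF \<open>T c = T c'\<close>, of n] by (simp add: T_def h_def subst_fps_diff)
  qed
  ultimately show thesis
    by (rule that)
qed

theorem theorem1:
  fixes s :: "nat \<Rightarrow> 'a::{field, finite}" and N :: nat
  assumes "N > 0"
  shows "(expansion_complexity s N + 1) choose 2 \<le> N"
proof (rule ccontr)
  assume "\<not> ?thesis"
  then have "N < (expansion_complexity s N + 1) choose 2"
    by simp
  then obtain h :: "'a poly poly" where h: "h \<noteq> 0"
      "total_degree h < expansion_complexity s N" "fps_X ^ N dvd subst_fps h (Abs_fps s)"
    by (rule exists_annihilating_poly)
  \<comment> \<open>Here \<open>d\<close> was the complexity itself. If the first N terms vanish,
    the complexity is 0; otherwise \<open>h\<close> competes in the minimum.\<close>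
  then have "expansion_complexity s N \<le> total_degree h"
    unfolding expansion_complexity_def by (simp only: le0 split: if_split) (blast intro: Least_le)
  with h(2) show False
    by simp
qed

end
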